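(* Let $m\in\mathbb{N}$ and let $\mathbf b=(b_n)_{n\ge0}$ be a sequence of complex numbers with $b_0\neq0$. Let $\mathbf a=(a_n)_{n\ge0}$ satisfy $a_n=\sum_{j=0}^{n+m}b_{n+m-j}a_j$ for all $n\in\mathbb{N}_0$. With the sequences $\alpha_k$ and the formal power series $A,B,G\alpha_k$ defined in the context, the following relations hold (as identities of power series in $s$): 1. $\displaystyle\sum_{k=0}^{m-1}a_k\sum_{n=k}^{m-1}b_{n-k}s^n=A(s)\big(B(s)-s^m\big)$; 2. $\displaystyle A(s)=\sum_{j=0}^{m-1}a_j\,G\alpha_j(s)$; 3. for every $k=0,1,\ldots,m-1$: $\displaystyle G\alpha_k(s)\big(B(s)-s^m\big)=\sum_{n=k}^{m-1}b_{n-k}s^n$; 4. $\displaystyle a_n-a_{n-1}=\sum_{k=0}^{m-1}a_k\big(\alpha_k(n)-\alpha_k(n-1)\big)$ for all $n\in\mathbb{N}$; 5. for every $k$ and $n\in\mathbb{N}$: $\displaystyle \alpha_k(n)-\alpha_k(n-1)=\frac{1}{n!}\lim_{s\to0}\frac{\partial^n}{\partial s^n}\big((1-s)G\alpha_k(s)\big)$, i.e. $\alpha_k(n)-\alpha_k(n-1)$ is the coefficient of $s^n$ in $(1-s)G\alpha_k(s)$; 6. for every $k$ and $n\in\mathbb{N}_0$: $\displaystyle \alpha_k(n)=\frac{1}{n!}\lim_{s\to0}\frac{\partial^n}{\partial s^n}G\alpha_k(s)$, i.e. $\alpha_k(n)$ is the coefficient of $s^n$ in $G\alpha_k(s)$.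
   Context: For each $k\in\{0,1,\ldots,m-1\}$ the sequence $(\alpha_k(n))_{n\ge0}$ is defined by $\alpha_k(j)=1$ if $j=k$, $\alpha_k(j)=0$ if $j\in\{0,\ldots,m-1\}\setminus\{k\}$, and for $n\ge m$ by $\alpha_k(n)=\frac{1}{b_0}\big(\alpha_k(n-m)-\sum_{j=0}^{n-1}b_{n-j}\alpha_k(j)\big)$. The formal power series are $A(s)=\sum_{n\ge0}a_ns^n$, $B(s)=\sum_{n\ge0}b_ns^n$, and $G\alpha_k(s)=\sum_{n\ge0}\alpha_k(n)s^n$ for $k=0,\ldots,m-1$. *)

theory Defs
  imports Complex_Main "HOL-Computational_Algebra.Formal_Power_Series"
begin

text \<open>The case \<open>m = 0\<close> is excluded in the second branch only so that the recursion
  terminates; the recurrence is meant for \<open>m \<ge> 1\<close>, see \<open>alpha_initial\<close> and \<open>alpha_rec\<close>.\<close>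

function alpha :: "(nat \<Rightarrow> complex) \<Rightarrow> nat \<Rightarrow> nat \<Rightarrow> nat \<Rightarrow> complex" where
  "alpha b m k n =
     (if n < m then (if n = k then 1 else 0)
      else if m = 0 then 0
      else 1 / b 0 * (alpha b m k (n - m) - (\<Sum>j<n. b (n - j) * alpha b m k j)))"
  by pat_completeness auto
termination
  by (relation "measure (\<lambda>(b, m, k, n). n)") auto

declare alpha.simps [simp del]

lemma alpha_initial: "j < m \<Longrightarrow> alpha b m k j = (if j = k then 1 else 0)"
  by (subst alpha.simps) simp

lemma alpha_rec:
  assumes "m \<ge> 1" and "n \<ge> m"
  shows "alpha b m k n =
    1 / b 0 * (alpha b m k (n - m) - (\<Sum>j = 0..n - 1. b (n - j) * alpha b m k j))"
proof -
  have "{0..n - 1} = {..<n}"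
    using assms by auto
  then show ?thesis
    using assms by (subst alpha.simps) simp
qed

definition G_alpha :: "(nat \<Rightarrow> complex) \<Rightarrow> nat \<Rightarrow> nat \<Rightarrow> complex fps" where
  "G_alpha b m k = Abs_fps (alpha b m k)"

text \<open>No convergence is assumed, so \<open>lim\<^sub>s\<^sub>\<rightarrow>\<^sub>0\<close> of the \<open>n\<close>-th derivative of a formal power
  series is the constant term of its \<open>n\<close>-th formal derivative.\<close>

definition deriv_at_0 :: "nat \<Rightarrow> complex fps \<Rightarrow> complex" where
  "deriv_at_0 n F = fps_nth ((fps_deriv ^^ n) F) 0"

end

theory Submission imports Defs begin

unbundle fps_syntax

text \<open>A sequence whose convolution with \<open>b\<close>, delayed by \<open>m\<close>, returns the sequence itself has a
  generating function \<open>C\<close> for which \<open>C (B - X\<^sup>m)\<close> is a polynomial of degree below \<open>m\<close>, determined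
  by the initial values \<open>c\<^sub>0, \<dots>, c\<^sub>m\<^sub>-\<^sub>1\<close>. Both \<open>a\<close> and every \<open>\<alpha>\<^sub>k\<close> are such sequences. As
  \<open>B - X\<^sup>m\<close> has the constant term \<open>b\<^sub>0 \<noteq> 0\<close>, it can be cancelled, so \<open>A\<close> is the combination of the
  \<open>G\<alpha>\<^sub>k\<close> with the same initial values.\<close>

lemma fps_times_diff_X_power:
  fixes b c :: "nat \<Rightarrow> 'a::comm_ring_1"
  assumes rec: "\<And>n. c n = (\<Sum>j\<le>n + m. b (n + m - j) * c j)"
  shows "Abs_fps c * (Abs_fps b - fps_X ^ m) =
    (\<Sum>k<m. fps_const (c k) * (\<Sum>n\<in>{k..<m}. fps_const (b (n - k)) * fps_X ^ n))"
    (is "?L = ?R")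
proof (rule fps_ext)
  fix n
  have L: "?L $ n = (\<Sum>j\<le>n. b (n - j) * c j) - (if n < m then 0 else c (n - m))"
    unfolding right_diff_distrib fps_sub_nth fps_X_power_mult_right_nth
    by (simp add: fps_mult_nth atLeast0AtMost mult.commute[of "b _"])
  have P: "(\<Sum>i\<in>{k..<m}. fps_const (b (i - k)) * fps_X ^ i) $ n =
      (if k \<le> n \<and> n < m then b (n - k) else 0)" for k
  proof -
    have "(\<Sum>i\<in>{k..<m}. fps_const (b (i - k)) * fps_X ^ i) $ n =
        (\<Sum>i\<in>{k..<m}. if n = i then b (i - k) else 0)"
      unfolding fps_sum_nth fps_mult_left_const_nth fps_X_power_nth by (rule sum.cong) auto
    then show ?thesis
      by simp
  qed
  have R: "?R $ n = (\<Sum>k<m. if k \<le> n \<and> n < m then b (n - k) * c k else 0)"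
    by (subst fps_sum_nth, rule sum.cong) (simp_all only: fps_mult_left_const_nth P, auto)
  \<comment> \<open>Below degree \<open>m\<close> the term \<open>fps_X ^ m\<close> contributes
    nothing, and both sides are the same convolution. From degree \<open>m\<close> on the right side
    vanishes, and on the left the recurrence at \<open>n - m\<close> makes the two terms
    cancel.\<close>
  show "?L $ n = ?R $ n"
  proof (cases "n < m")
    case True
    then have "?R $ n = (\<Sum>k\<in>{k\<in>{..<m}. k \<le> n}. b (n - k) * c k)"
      unfolding R by (subst sum.inter_filter) auto
    also have "{k\<in>{..<m}. k \<le> n} = {..n}"
      using True by auto
    finally show ?thesis
      unfolding L using True by simp
  next
    case False
    then show ?thesis
      unfolding L R using rec[of "n - m"] by simp
  qed
qed

text \<open>The summand \<open>j = n + m\<close> has the factor \<open>b 0\<close>; solving for it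
  gives the defining recursion at index \<open>n + m\<close>. So every
  \<open>\<alpha>\<^sub>k\<close> satisfies the recurrence assumed for \<open>a\<close>.\<close>

lemma alpha_convolution:
  assumes "m \<ge> 1" and "b 0 \<noteq> 0"
  shows "alpha b m k n = (\<Sum>j\<le>n + m. b (n + m - j) * alpha b m k j)"
proof -
  have "{0..n + m - 1} = {..<n + m}"
    using assms(1) by auto
  then have "b 0 * alpha b m k (n + m) =
      alpha b m k n - (\<Sum>j<n + m. b (n + m - j) * alpha b m k j)"
    using alpha_rec[of m "n + m" b k] assms by simp
  moreover have "(\<Sum>j\<le>n + m. b (n + m - j) * alpha b m k j) =
      (\<Sum>j<n + m. b (n + m - j) * alpha b m k j) + b 0 * alpha b m k (n + m)"
    by (simp flip: lessThan_Suc_atMost)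
  ultimately show ?thesis
    by simp
qed

text \<open>Formal Taylor formula: it turns the limits of derivatives into coefficients. The
  induction splits off the innermost derivative, hence the arbitrary \<open>F\<close>.\<close>

lemma deriv_at_0_eq_fact_times_nth: "deriv_at_0 n F = fact n * F $ n"
proof (induction n arbitrary: F)
  case 0
  then show ?case by (simp add: deriv_at_0_def)
next
  case (Suc n)
  have "deriv_at_0 (Suc n) F = deriv_at_0 n (fps_deriv F)"
    by (simp add: deriv_at_0_def funpow_Suc_right del: funpow.simps)
  then show ?case
    by (simp add: Suc.IH algebra_simps)
qed

theorem theorem1:
  fixes m :: nat and a b :: "nat \<Rightarrow> complex" and A B :: "complex fps"
  assumes "m \<ge> 1"
    and "b 0 \<noteq> 0"
    and "\<forall>n. a n = (\<Sum>j = 0..n + m. b (n + m - j) * a j)"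
    and "A = Abs_fps a"
    and "B = Abs_fps b"
  shows
    "(\<Sum>k<m. fps_const (a k) * (\<Sum>n\<in>{k..<m}. fps_const (b (n - k)) * fps_X ^ n))
       = A * (B - fps_X ^ m)
     \<and> A = (\<Sum>j<m. fps_const (a j) * G_alpha b m j)
     \<and> (\<forall>k<m. G_alpha b m k * (B - fps_X ^ m)
              = (\<Sum>n\<in>{k..<m}. fps_const (b (n - k)) * fps_X ^ n))
     \<and> (\<forall>n\<ge>1. a n - a (n - 1)
              = (\<Sum>k<m. a k * (alpha b m k n - alpha b m k (n - 1))))
     \<and> (\<forall>k<m. \<forall>n\<ge>1.
          alpha b m k n - alpha b m k (n - 1)
            = 1 / fact n * deriv_at_0 n ((1 - fps_X) * G_alpha b m k)
          \<and> alpha b m k n - alpha b m k (n - 1)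
            = fps_nth ((1 - fps_X) * G_alpha b m k) n)
     \<and> (\<forall>k<m. \<forall>n.
          alpha b m k n = 1 / fact n * deriv_at_0 n (G_alpha b m k)
          \<and> alpha b m k n = fps_nth (G_alpha b m k) n)"
proof -
  let ?P = "\<lambda>k. \<Sum>n\<in>{k..<m}. fps_const (b (n - k)) * fps_X ^ n"
  have A: "A * (B - fps_X ^ m) = (\<Sum>k<m. fps_const (a k) * ?P k)"
    unfolding assms(4,5)
    by (rule fps_times_diff_X_power, fold atLeast0AtMost) (rule assms(3)[rule_format])
  have G: "G_alpha b m k * (B - fps_X ^ m) = ?P k" if "k < m" for k
  proof -
    have "G_alpha b m k * (B - fps_X ^ m) = (\<Sum>i<m. fps_const (alpha b m k i) * ?P i)"
      unfolding G_alpha_def assms(5)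
      by (rule fps_times_diff_X_power) (rule alpha_convolution, fact+)
    \<comment> \<open>The initial values of \<open>\<alpha>\<^sub>k\<close> are a Kronecker delta,
      so only \<open>?P k\<close> survives.\<close>
    also have "\<dots> = (\<Sum>i<m. if i = k then ?P i else 0)"
      by (rule sum.cong) (auto simp: alpha_initial)
    also have "\<dots> = ?P k"
      using that by simp
    finally show ?thesis .
  qed
  \<comment> \<open>Since \<open>m \<ge> 1\<close>, the constant term is \<open>b 0\<close>.\<close>
  have "(B - fps_X ^ m) $ 0 \<noteq> 0"
    using assms(1,2,5) by simp
  then have nz: "B - fps_X ^ m \<noteq> 0"
    by (metis fps_zero_nth)
  have "(\<Sum>j<m. fps_const (a j) * G_alpha b m j) * (B - fps_X ^ m) = A * (B - fps_X ^ m)"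
    unfolding A sum_distrib_right by (rule sum.cong) (simp_all add: mult.assoc G)
  with nz have AG: "A = (\<Sum>j<m. fps_const (a j) * G_alpha b m j)"
    by simp
  have a: "a n = (\<Sum>k<m. a k * alpha b m k n)" for n
    using arg_cong[OF AG, of "\<lambda>F. F $ n"] by (simp add: assms(4) fps_sum_nth G_alpha_def)
  have diff: "a n - a (n - 1) = (\<Sum>k<m. a k * (alpha b m k n - alpha b m k (n - 1)))" for n
    unfolding a[of n] a[of "n - 1"] by (simp add: right_diff_distrib sum_subtractf)
  have nth: "alpha b m k n = G_alpha b m k $ n" for k n
    by (simp add: G_alpha_def)
  \<comment> \<open>At \<open>n = 0\<close> truncated subtraction would make the left side 0,
    whereas the constant term on the right is \<open>alpha b m k 0\<close>.\<close>
  have nth_diff: "alpha b m k n - alpha b m k (n - 1) = ((1 - fps_X) * G_alpha b m k) $ n"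
    if "n \<ge> 1" for k n
    using that by (simp add: left_diff_distrib nth)
  have deriv: "F $ n = 1 / fact n * deriv_at_0 n F" for n F
    by (simp add: deriv_at_0_eq_fact_times_nth)
  show ?thesis
  proof (intro conjI allI impI)
    show "alpha b m k n = 1 / fact n * deriv_at_0 n (G_alpha b m k)" for k n
      unfolding deriv[symmetric] by (rule nth)
    show "alpha b m k n - alpha b m k (n - 1)
        = 1 / fact n * deriv_at_0 n ((1 - fps_X) * G_alpha b m k)" if "n \<ge> 1" for k n
      unfolding deriv[symmetric] by (rule nth_diff[OF that])
  qed (rule A[symmetric] AG G diff nth nth_diff; assumption)+
qed

end
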